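(* Every graph on at most five vertices is $132$-representable.
   Context: All graphs are finite and simple, and vertex labels are taken from a totally ordered set. For a finite word $w$, $A(w)$ is the set of letters occurring in $w$. Two distinct letters $x,y\in A(w)$ alternate in $w$ if deleting from $w$ all letters other than $x$ and $y$ leaves a word of the form $xyxy\cdots$ or $yxyx\cdots$ (of even or odd length). A word $w$ represents a graph $G=(V,E)$ if $A(w)=V$ and, for all $x\ne y$ in $V$, $x$ and $y$ alternate in $w$ if and only if $xy\in E$. A word $w=w_1\cdots w_m$ avoids the pattern $132$ (is $132$-avoiding) if there are no indices $i_1<i_2<i_3$ with $w_{i_1}<w_{i_3}<w_{i_2}$. A graph $G$ is $132$-representable if, possibly after relabelling its vertices by elements of a totally ordered set, there is a $132$-avoiding word that represents $G$. *)

theory Defs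
  imports "Graph_Theory.Pair_Digraph"
begin

text \<open>
  Finite simple graphs are the library's \<open>pair_graph\<close>s: finite, loop-free, symmetric sets of
  ordered pairs. An undirected edge \<open>xy\<close> is present iff \<open>(x, y) \<in> parcs G\<close>.
  A word is a list.
\<close>

definition alt_word :: "'a \<Rightarrow> 'a \<Rightarrow> nat \<Rightarrow> 'a list" where
  "alt_word x y n = map (\<lambda>i. if even i then x else y) [0..<n]"

definition alternate :: "'a \<Rightarrow> 'a \<Rightarrow> 'a list \<Rightarrow> bool" where
  "alternate x y w \<longleftrightarrow>
     x \<noteq> y \<and> x \<in> set w \<and> y \<in> set w \<and>
     (\<exists>n. filter (\<lambda>z. z \<in> {x, y}) w = alt_word x y n \<or>
          filter (\<lambda>z. z \<in> {x, y}) w = alt_word y x n)"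

definition word_represents :: "'a list \<Rightarrow> 'a pair_pre_digraph \<Rightarrow> bool" where
  "word_represents w G \<longleftrightarrow>
     set w = pverts G \<and>
     (\<forall>x \<in> pverts G. \<forall>y \<in> pverts G. x \<noteq> y \<longrightarrow> (alternate x y w \<longleftrightarrow> (x, y) \<in> parcs G))"

definition avoids_132 :: "'a::linorder list \<Rightarrow> bool" where
  "avoids_132 w \<longleftrightarrow>
     \<not> (\<exists>i j k. i < j \<and> j < k \<and> k < length w \<and> w ! i < w ! k \<and> w ! k < w ! j)"

definition relabel :: "('a \<Rightarrow> 'b) \<Rightarrow> 'a pair_pre_digraph \<Rightarrow> 'b pair_pre_digraph" where
  "relabel f G = \<lparr> pverts = f ` pverts G, parcs = map_prod f f ` parcs G \<rparr>"

text \<open>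
  HOL cannot quantify over the totally ordered type of labels inside a definition, so labels
  are natural numbers. For finite graphs this is no restriction: see
  \<open>representable_132_if_any_labels\<close> below.
\<close>

definition representable_132 :: "'a pair_pre_digraph \<Rightarrow> bool" where
  "representable_132 G \<longleftrightarrow>
     (\<exists>(f :: 'a \<Rightarrow> nat) w. inj_on f (pverts G) \<and> avoids_132 w \<and> word_represents w (relabel f G))"

lemma filter_map_pair:
  assumes "inj_on g (set w)" "x \<in> set w" "y \<in> set w"
  shows "filter (\<lambda>z. z \<in> {g x, g y}) (map g w) = map g (filter (\<lambda>z. z \<in> {x, y}) w)"
proof -
  have "filter (\<lambda>z. g z \<in> {g x, g y}) w = filter (\<lambda>z. z \<in> {x, y}) w"
    using assms by (intro filter_cong refl) (auto dest: inj_onD)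
  then show ?thesis by (simp add: filter_map o_def)
qed

lemma map_alt_word: "map g (alt_word x y n) = alt_word (g x) (g y) n"
  by (simp add: alt_word_def)

lemma set_alt_word: "set (alt_word x y n) \<subseteq> {x, y}"
  by (auto simp: alt_word_def)

lemma map_eq_alt_word_iff:
  assumes inj: "inj_on g (set w)" and "x \<in> set w" "y \<in> set w" "set u \<subseteq> set w"
  shows "map g u = alt_word (g x) (g y) n \<longleftrightarrow> u = alt_word x y n"
proof -
  have "set u \<union> set (alt_word x y n) \<subseteq> set w" using assms set_alt_word[of x y n] by auto
  then have "inj_on g (set u \<union> set (alt_word x y n))" using inj inj_on_subset by blast
  then show ?thesis by (metis inj_on_map_eq_map map_alt_word)
qed

lemma alternate_map:
  assumes inj: "inj_on g (set w)" and x: "x \<in> set w" and y: "y \<in> set w"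
  shows "alternate (g x) (g y) (map g w) \<longleftrightarrow> alternate x y w"
proof -
  let ?u = "filter (\<lambda>z. z \<in> {x, y}) w"
  have sub: "set ?u \<subseteq> set w" by auto
  have "g x \<noteq> g y \<longleftrightarrow> x \<noteq> y" using inj x y by (auto dest: inj_onD)
  then show ?thesis
    unfolding alternate_def filter_map_pair[OF inj x y]
      map_eq_alt_word_iff[OF inj x y sub] map_eq_alt_word_iff[OF inj y x sub]
    using x y by simp
qed

lemma arc_relabel_iff:
  assumes G: "pair_graph G" and h: "inj_on h (pverts G)" and ab: "a \<in> pverts G" "b \<in> pverts G"
  shows "(h a, h b) \<in> parcs (relabel h G) \<longleftrightarrow> (a, b) \<in> parcs G"
proof
  interpret pair_graph G by (rule G)
  assume "(h a, h b) \<in> parcs (relabel h G)"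
  then obtain c d where cd: "(c, d) \<in> parcs G" "h a = h c" "h b = h d"
    by (auto simp: relabel_def)
  then have "a = c" "b = d"
    using inj_onD[OF h _ ab(1)] inj_onD[OF h _ ab(2)] in_arcsD1 in_arcsD2 by blast+
  with cd show "(a, b) \<in> parcs G" by simp
next
  assume "(a, b) \<in> parcs G"
  then show "(h a, h b) \<in> parcs (relabel h G)" by (force simp: relabel_def)
qed

lemma representable_132_if_any_labels:
  fixes f :: "'a \<Rightarrow> 'b::linorder"
  assumes G: "pair_graph G" and f: "inj_on f (pverts G)"
    and av: "avoids_132 w" and rep: "word_represents w (relabel f G)"
  shows "representable_132 G"
proof -
  define g where "g y = card {z \<in> set w. z < y}" for y
  have mono: "g x < g y" if "x \<in> set w" "x < y" for x y
    unfolding g_def using that by (intro psubset_card_mono) auto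
  then have inj: "inj_on g (set w)"
    by (metis inj_onI less_irrefl linorder_neqE)
  have less: "g x < g y \<longleftrightarrow> x < y" if "x \<in> set w" "y \<in> set w" for x y
    using mono[of x y] mono[of y x] that by (metis less_asym less_irrefl linorder_neqE)
  have setw: "set w = f ` pverts G" using rep by (simp add: word_represents_def relabel_def)
  have 1: "inj_on (g \<circ> f) (pverts G)"
    using f inj setw by (simp add: comp_inj_on)
  have 2: "avoids_132 (map g w)"
    unfolding avoids_132_def
  proof (intro notI, elim exE conjE)
    fix i j k
    assume "i < j" "j < k" "k < length (map g w)"
      "map g w ! i < map g w ! k" "map g w ! k < map g w ! j"
    moreover from this have "w ! i < w ! k" "w ! k < w ! j"
      by (simp_all add: less)
    ultimately show False using av unfolding avoids_132_def by simp
  qed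
  have "word_represents (map g w) (relabel (g \<circ> f) G)"
    unfolding word_represents_def
  proof (intro conjI ballI impI)
    show "set (map g w) = pverts (relabel (g \<circ> f) G)"
      by (simp add: setw relabel_def image_comp)
  next
    fix x y assume xy: "x \<in> pverts (relabel (g \<circ> f) G)" "y \<in> pverts (relabel (g \<circ> f) G)" "x \<noteq> y"
    then obtain a b where ab: "a \<in> pverts G" "b \<in> pverts G" "x = g (f a)" "y = g (f b)"
      by (auto simp: relabel_def)
    have fne: "f a \<noteq> f b" and fv: "f a \<in> pverts (relabel f G)" "f b \<in> pverts (relabel f G)"
      using ab xy(3) by (auto simp: relabel_def)
    have "alternate x y (map g w) \<longleftrightarrow> alternate (f a) (f b) w"
      using ab setw alternate_map[OF inj] by simp
    also have "\<dots> \<longleftrightarrow> (f a, f b) \<in> parcs (relabel f G)"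
      using rep fne fv unfolding word_represents_def by blast
    also have "\<dots> \<longleftrightarrow> (x, y) \<in> parcs (relabel (g \<circ> f) G)"
      using arc_relabel_iff[OF G 1 ab(1,2)] arc_relabel_iff[OF G f ab(1,2)] ab by simp
    finally show "alternate x y (map g w) \<longleftrightarrow> (x, y) \<in> parcs (relabel (g \<circ> f) G)" .
  qed
  with 1 2 show ?thesis unfolding representable_132_def by blast
qed

end

theory Submission
  imports Defs
begin

text \<open>
  The class of \<open>132\<close>-representable graphs is closed under induced subgraphs: deleting letters from
  a word creates no new \<open>132\<close> pattern and does not affect whether two remaining letters alternate
  (lemma \<open>representable_132_if_embeds\<close>). So one word settles all graphs on at most five
  vertices as soon as the graph it represents contains each of them as an induced subgraph. Such
  a word is \<open>J K H F G H I E F C D I J K B A C K\<close>,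
  where \<open>A < B < \<dots> < K\<close>. It avoids \<open>132\<close>, and its eleven letters span a graph with
  26 edges in which each of the 34 graphs on five vertices occurs. The word has no deeper
  structure: it comes from a computer search for \<open>132\<close>-avoiding words that represent a graph
  with many induced subgraphs.

  Universality of that graph is a finite check. A labelled graph on five vertices is given by ten
  bits, one for each pair of vertices, and for each of the 1024 choices a depth-first search finds
  five letters with the prescribed adjacencies (lemma \<open>five_vertex_universal\<close>). A graph on fewer
  vertices is first padded with isolated vertices, whose letters are deleted again with the others.
\<close>

section \<open>Alternation and pattern avoidance, recursively\<close>

lemma distinct_adj_alt_word: "x \<noteq> y \<Longrightarrow> distinct_adj (alt_word x y n)"
  by (simp add: alt_word_def distinct_adj_conv_nth)

lemma alt_word_Suc: "alt_word x y (Suc n) = x # alt_word y x n"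
  by (simp add: alt_word_def upt_conv_Cons map_Suc_upt[symmetric] del: upt_Suc)

lemma alt_word_if_distinct_adj:
  assumes "distinct_adj (x # u)" "set (x # u) \<subseteq> {x, y}"
  shows "x # u = alt_word x y (Suc (length u))"
  using assms
proof (induction u arbitrary: x y)
  case Nil
  then show ?case by (simp add: alt_word_def)
next
  case (Cons z u)
  then have "z = y" by auto
  with Cons show ?case
    using Cons.IH[of y x] by (simp add: alt_word_Suc[of x] insert_commute)
qed

lemma alternate_iff_distinct_adj:
  "alternate x y w \<longleftrightarrow>
     x \<noteq> y \<and> x \<in> set w \<and> y \<in> set w \<and> distinct_adj (filter (\<lambda>z. z = x \<or> z = y) w)"
proof -
  let ?u = "filter (\<lambda>z. z \<in> {x, y}) w"
  have "(\<exists>n. ?u = alt_word x y n \<or> ?u = alt_word y x n) \<longleftrightarrow> distinct_adj ?u" if "x \<noteq> y"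
  proof
    assume "\<exists>n. ?u = alt_word x y n \<or> ?u = alt_word y x n"
    then show "distinct_adj ?u"
      using that distinct_adj_alt_word by metis
  next
    assume d: "distinct_adj ?u"
    show "\<exists>n. ?u = alt_word x y n \<or> ?u = alt_word y x n"
    proof (cases ?u)
      case Nil
      then have "?u = alt_word x y 0" by (simp add: alt_word_def)
      then show ?thesis by blast
    next
      case (Cons a v)
      have sub: "set (a # v) \<subseteq> {x, y}" by (subst Cons[symmetric]) auto
      then consider "a = x" | "a = y" by auto
      then show ?thesis
      proof cases
        case 1
        then have "?u = alt_word x y (Suc (length v))"
          using alt_word_if_distinct_adj[of a v y] d sub unfolding Cons by simp
        then show ?thesis by blast
      next
        case 2
        then have "?u = alt_word y x (Suc (length v))"
          using alt_word_if_distinct_adj[of a v x] d sub unfolding Cons by (simp add: insert_commute)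
        then show ?thesis by blast
      qed
    qed
  qed
  then show ?thesis unfolding alternate_def by auto
qed

lemma avoids_132_Nil: "avoids_132 []"
  by (simp add: avoids_132_def)

lemma avoids_132_Cons:
  "avoids_132 (x # w) \<longleftrightarrow> sorted_wrt (\<lambda>b c. x < c \<longrightarrow> b \<le> c) w \<and> avoids_132 w" (is "?L \<longleftrightarrow> ?R")
proof
  assume L: ?L
  have no: "(x # w) ! j \<le> (x # w) ! k"
    if "i < j" "j < k" "k < length (x # w)" "(x # w) ! i < (x # w) ! k" for i j k
    using L that unfolding avoids_132_def by (meson not_le)
  have "sorted_wrt (\<lambda>b c. x < c \<longrightarrow> b \<le> c) w"
    unfolding sorted_wrt_iff_nth_less
  proof (intro allI impI)
    fix j k assume "j < k" "k < length w" "x < w ! k"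
    then show "w ! j \<le> w ! k" using no[of 0 "Suc j" "Suc k"] by simp
  qed
  moreover have "avoids_132 w"
    unfolding avoids_132_def
  proof (intro notI, elim exE conjE)
    fix i j k assume "i < j" "j < k" "k < length w" "w ! i < w ! k" "w ! k < w ! j"
    then show False using no[of "Suc i" "Suc j" "Suc k"] by simp
  qed
  ultimately show ?R by blast
next
  assume R: ?R
  show ?L
    unfolding avoids_132_def
  proof (intro notI, elim exE conjE)
    fix i j k
    assume *: "i < j" "j < k" "k < length (x # w)"
      "(x # w) ! i < (x # w) ! k" "(x # w) ! k < (x # w) ! j"
    then obtain j' k' where jk: "j = Suc j'" "k = Suc k'"
      by (metis less_nat_zero_code not0_implies_Suc)
    show False
    proof (cases i)
      case 0
      with * jk have "\<not> w ! j' \<le> w ! k'" "x < w ! k'" "j' < k'" "k' < length w" by auto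
      then show False using R unfolding sorted_wrt_iff_nth_less by blast
    next
      case (Suc i')
      with * jk show False using R unfolding avoids_132_def by auto
    qed
  qed
qed

lemma avoids_132_filter: "avoids_132 w \<Longrightarrow> avoids_132 (filter P w)"
  by (induction w) (auto simp: avoids_132_Cons avoids_132_Nil intro: sorted_wrt_filter)

section \<open>Induced subgraphs\<close>

text \<open>
  Deleting from \<open>w\<close> all letters outside the image of \<open>h\<close> leaves a word for the induced subgraph,
  because alternation of two letters depends only on the occurrences of these two.
\<close>

lemma representable_132_if_embeds:
  fixes h :: "'a \<Rightarrow> 'b::linorder"
  assumes G: "pair_graph G" and w: "avoids_132 w"
    and inj: "inj_on h (pverts G)" and sub: "h ` pverts G \<subseteq> set w"
    and adj: "\<And>x y. x \<in> pverts G \<Longrightarrow> y \<in> pverts G \<Longrightarrow> x \<noteq> y \<Longrightarrow>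
      alternate (h x) (h y) w \<longleftrightarrow> (x, y) \<in> parcs G"
  shows "representable_132 G"
proof -
  let ?v = "filter (\<lambda>z. z \<in> h ` pverts G) w"
  have "alternate (h x) (h y) ?v \<longleftrightarrow> (h x, h y) \<in> parcs (relabel h G)"
    if xy: "x \<in> pverts G" "y \<in> pverts G" "h x \<noteq> h y" for x y
  proof -
    have "filter (\<lambda>z. z \<in> {h x, h y}) ?v = filter (\<lambda>z. z \<in> {h x, h y}) w"
      unfolding filter_filter using xy by (intro filter_cong) auto
    then have "alternate (h x) (h y) ?v \<longleftrightarrow> alternate (h x) (h y) w"
      unfolding alternate_def using xy by auto
    also have "\<dots> \<longleftrightarrow> (x, y) \<in> parcs G"
      using adj[of x y] xy by blast
    also have "\<dots> \<longleftrightarrow> (h x, h y) \<in> parcs (relabel h G)"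
      using arc_relabel_iff[OF G inj xy(1,2)] by simp
    finally show ?thesis .
  qed
  moreover have "set ?v = h ` pverts G"
    using sub by auto
  ultimately have "word_represents ?v (relabel h G)"
    unfolding word_represents_def by (auto simp: relabel_def)
  then show ?thesis
    using representable_132_if_any_labels[OF G inj avoids_132_filter[OF w]] by blast
qed

section \<open>A universal word\<close>

text \<open>
  Letters are constants of their own rather than numbers because the search below compares them
  constantly, and distinct constructors are told apart in a single rewrite step.
\<close>

datatype letter = A | B | C | D | E | F | G | H | I | J | K

primrec rank :: "letter \<Rightarrow> nat" where
  "rank A = 0" | "rank B = 1" | "rank C = 2" | "rank D = 3" | "rank E = 4" | "rank F = 5"
| "rank G = 6" | "rank H = 7" | "rank I = 8" | "rank J = 9" | "rank K = 10"

lemma rank_inject: "rank x = rank y \<longleftrightarrow> x = y"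
  by (cases x; cases y) simp_all

definition universal_word :: "letter list" where
  "universal_word = [J, K, H, F, G, H, I, E, F, C, D, I, J, K, B, A, C, K]"

lemma avoids_132_universal_word: "avoids_132 (map rank universal_word)"
  by (simp add: universal_word_def avoids_132_Cons avoids_132_Nil)

lemma set_universal_word: "x \<in> set universal_word"
  by (cases x) (simp_all add: universal_word_def)

text \<open>The graph that \<open>universal_word\<close> represents, tabulated for the search.\<close>

primrec adj :: "letter \<Rightarrow> letter \<Rightarrow> bool" where
  "adj A y \<longleftrightarrow> y \<in> set [B, C, D, E, G]"
| "adj B y \<longleftrightarrow> y \<in> set [A, C, D, E, G]"
| "adj C y \<longleftrightarrow> y \<in> set [A, B, D, I, J, K]"
| "adj D y \<longleftrightarrow> y \<in> set [A, B, C, E, G, I, J]"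
| "adj E y \<longleftrightarrow> y \<in> set [A, B, D, F, G, I, J]"
| "adj F y \<longleftrightarrow> y \<in> set [E, G, H, I]"
| "adj G y \<longleftrightarrow> y \<in> set [A, B, D, E, F, H, J]"
| "adj H y \<longleftrightarrow> y \<in> set [F, G]"
| "adj I y \<longleftrightarrow> y \<in> set [C, D, E, F]"
| "adj J y \<longleftrightarrow> y \<in> set [C, D, E, G]"
| "adj K y \<longleftrightarrow> y \<in> set [C]"

lemma adj_iff_alternate: "adj x y \<longleftrightarrow> alternate x y universal_word"
  unfolding alternate_iff_distinct_adj universal_word_def
  by (cases x; cases y) simp_all

lemma adj_sym: "adj x y \<longleftrightarrow> adj y x"
  by (cases x; cases y) simp_all

lemma alternate_rank_universal_word:
  "alternate (rank x) (rank y) (map rank universal_word) \<longleftrightarrow> adj x y"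
  unfolding adj_iff_alternate
  by (intro alternate_map set_universal_word) (simp add: inj_on_def rank_inject)

text \<open>
  The order in which the search tries the letters. It affects only the length of the search: with
  this one, about a hundred thousand letters are tried in total.
\<close>

definition letters :: "letter list" where
  "letters = [I, G, K, C, A, E, F, H, D, J, B]"

text \<open>
  The bit \<open>pij\<close> says whether the vertices \<open>i\<close> and \<open>j\<close> are adjacent. Each letter is tested against
  the earlier ones right after its choice, so that evaluating the quantifiers from left to right
  is a backtracking search.
\<close>

lemma five_vertex_universal:
  "\<forall>p01 p02 p12 p03 p13 p23 p04 p14 p24 p34.
   \<exists>a\<in>set letters.
   \<exists>b\<in>set letters. adj b a = p01 \<and> b \<noteq> a \<and>
  (\<exists>c\<in>set letters. adj c a = p02 \<and> adj c b = p12 \<and> c \<noteq> a \<and> c \<noteq> b \<and>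
  (\<exists>d\<in>set letters. adj d a = p03 \<and> adj d b = p13 \<and> adj d c = p23 \<and>
     d \<noteq> a \<and> d \<noteq> b \<and> d \<noteq> c \<and>
  (\<exists>e\<in>set letters. adj e a = p04 \<and> adj e b = p14 \<and> adj e c = p24 \<and> adj e d = p34 \<and>
     e \<noteq> a \<and> e \<noteq> b \<and> e \<noteq> c \<and> e \<noteq> d)))"
  unfolding letters_def by code_simp

lemma five_vertex_embedding:
  fixes R :: "nat \<Rightarrow> nat \<Rightarrow> bool"
  assumes sym: "\<And>i j. R i j \<longleftrightarrow> R j i"
  shows "\<exists>g. inj_on g {..<5} \<and> (\<forall>i<5. \<forall>j<5. i \<noteq> j \<longrightarrow> adj (g i) (g j) = R i j)"
proof -
  obtain a b c d e where abcde:
    "adj b a = R 0 1" "adj c a = R 0 2" "adj c b = R 1 2"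
    "adj d a = R 0 3" "adj d b = R 1 3" "adj d c = R 2 3"
    "adj e a = R 0 4" "adj e b = R 1 4" "adj e c = R 2 4" "adj e d = R 3 4"
    and neq: "b \<noteq> a" "c \<noteq> a" "c \<noteq> b" "d \<noteq> a" "d \<noteq> b" "d \<noteq> c"
    "e \<noteq> a" "e \<noteq> b" "e \<noteq> c" "e \<noteq> d"
    using five_vertex_universal[rule_format,
        of "R 0 1" "R 0 2" "R 1 2" "R 0 3" "R 1 3" "R 2 3" "R 0 4" "R 1 4" "R 2 4" "R 3 4"]
    by (elim bexE conjE) (rule that)
  have distinct: "distinct [a, b, c, d, e]"
    using neq by auto
  define g where "g i = [a, b, c, d, e] ! i" for i
  have five: "i = 0 \<or> i = 1 \<or> i = 2 \<or> i = 3 \<or> i = 4" if "i < 5" for i :: nat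
    using that by arith
  have less: "adj (g j) (g i) \<longleftrightarrow> R i j" if "i < j" "j < 5" for i j
  proof -
    have "i < 5" using that by simp
    from five[OF this] five[OF \<open>j < 5\<close>] \<open>i < j\<close> show ?thesis
      by (elim disjE) (simp_all add: g_def abcde)
  qed
  have "inj_on g {..<5}"
    using distinct unfolding g_def by (intro inj_onI) (simp add: nth_eq_iff_index_eq)
  moreover have "adj (g i) (g j) = R i j" if "i < 5" "j < 5" "i \<noteq> j" for i j
    using less[of i j] less[of j i] that sym[of i j] adj_sym[of "g i" "g j"]
    by (cases i j rule: linorder_cases) auto
  ultimately show ?thesis by blast
qed

section \<open>Graphs on at most five vertices\<close>

theorem mainTheorem6:
  fixes G :: "'a pair_pre_digraph"
  assumes "pair_graph G"
    and "card (pverts G) \<le> 5"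
  shows "representable_132 G"
proof -
  interpret pair_graph G by (rule assms(1))
  obtain f where f: "bij_betw f (pverts G) {..<card (pverts G)}"
    using ex_bij_betw_finite_nat[OF finite_verts] by (auto simp: atLeast0LessThan)
  then have f_inj: "inj_on f (pverts G)"
    by (rule bij_betw_imp_inj_on)
  have f_less: "f x < 5" if "x \<in> pverts G" for x
    using bij_betwE[OF f] that assms(2) by fastforce
  \<comment> \<open>Indices from \<open>card (pverts G)\<close> to \<open>4\<close> are related to nothing: these are the padding vertices.\<close>
  define R where "R i j \<longleftrightarrow> (\<exists>x y. (x, y) \<in> parcs G \<and> i = f x \<and> j = f y)" for i j
  have sym: "R i j \<longleftrightarrow> R j i" for i j
    unfolding R_def using arcs_symmetric by blast
  have R_iff: "R (f x) (f y) \<longleftrightarrow> (x, y) \<in> parcs G" if xy: "x \<in> pverts G" "y \<in> pverts G" for x y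
  proof
    assume "R (f x) (f y)"
    then obtain x' y' where *: "(x', y') \<in> parcs G" "f x = f x'" "f y = f y'"
      unfolding R_def by blast
    then have "x = x'" "y = y'"
      using inj_onD[OF f_inj _ xy(1)] inj_onD[OF f_inj _ xy(2)] in_arcsD1 in_arcsD2 by blast+
    with * show "(x, y) \<in> parcs G" by simp
  qed (auto simp: R_def)
  obtain g where g: "inj_on g {..<5}"
    and adj: "\<And>i j. i < 5 \<Longrightarrow> j < 5 \<Longrightarrow> i \<noteq> j \<Longrightarrow> adj (g i) (g j) \<longleftrightarrow> R i j"
    using five_vertex_embedding[of R, OF sym] by blast
  let ?h = "rank \<circ> g \<circ> f"
  have inj: "inj_on ?h (pverts G)"
    using inj_onD[OF g] inj_onD[OF f_inj] f_less by (intro inj_onI) (simp add: rank_inject)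
  show ?thesis
  proof (rule representable_132_if_embeds[OF assms(1) avoids_132_universal_word inj])
    show "?h ` pverts G \<subseteq> set (map rank universal_word)"
      using set_universal_word by auto
    show "alternate (?h x) (?h y) (map rank universal_word) \<longleftrightarrow> (x, y) \<in> parcs G"
      if "x \<in> pverts G" "y \<in> pverts G" "x \<noteq> y" for x y
      using that adj[of "f x" "f y"] f_less f_inj R_iff[of x y]
      by (simp add: alternate_rank_universal_word inj_on_eq_iff)
  qed
qed

end
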